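(* Let $g:[1,\infty)\to(0,\infty)$ be continuous and nondecreasing with $$\lim_{\tau\to\infty}\frac{\sqrt{\tau\log\log\tau}}{g(\tau)}=0\qquad\text{and}\qquad \lim_{T\to\infty}\sum_{\ell=0}^\infty\frac{2^\ell T}{g(2^\ell T)^2}=0.$$ Let $B$ be a standard Brownian motion on $[0,\infty)$ and $$G_g=\frac1{\left[\int_0^1\{B(u)-uB(1)\}^2du\right]^{1/2}}\ \sup_{\tau\ge1}\ \sup_{1\le r\le\tau}\frac{\left|B(r)-\frac r\tau B(\tau)\right|}{g(\tau)}.$$ Let $W$ and $W_0$ be independent standard Brownian motions on $[0,1]$. Then $$G_g\stackrel{d}{=}\frac1{\left[\int_0^1\{W_0(u)-uW_0(1)\}^2du\right]^{1/2}}\ \sup_{0<t\le v\le1}\frac{|W(v)-W(t)|}{v\,g(1/t)}.$$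
   Context: All Brownian motions are real-valued; $\stackrel{d}{=}$ denotes equality in distribution. *)

theory Defs
  imports "HOL-Probability.Probability"
begin

(* The process is indexed by the time set I; values of B at times outside I are unconstrained.
   The start at 0 and path continuity are only required almost surely. *)
definition std_brownian_motion :: "real set \<Rightarrow> 'a measure \<Rightarrow> (real \<Rightarrow> 'a \<Rightarrow> real) \<Rightarrow> bool" where
  "std_brownian_motion I M B \<longleftrightarrow>
     prob_space M \<and>
     (\<forall>t\<in>I. B t \<in> borel_measurable M) \<and>
     (AE \<omega> in M. B 0 \<omega> = 0) \<and>
     (AE \<omega> in M. continuous_on I (\<lambda>t. B t \<omega>)) \<and>
     (\<forall>(n::nat) t. (\<forall>i\<le>n. t i \<in> I) \<and> (\<forall>i<n. t i \<le> t (Suc i)) \<longrightarrow>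
        prob_space.indep_vars M (\<lambda>_. borel) (\<lambda>i \<omega>. B (t (Suc i)) \<omega> - B (t i) \<omega>) {..<n}) \<and>
     (\<forall>s\<in>I. \<forall>t\<in>I. s < t \<longrightarrow>
        distributed M lborel (\<lambda>\<omega>. B t \<omega> - B s \<omega>)
          (\<lambda>x. ennreal (normal_density 0 (sqrt (t - s)) x)))"

(* Independence of two processes with time set I, as random elements of the product space,
   i.e. independence of the sigma-algebras generated by all their coordinates. *)
definition indep_processes ::
  "real set \<Rightarrow> 'a measure \<Rightarrow> (real \<Rightarrow> 'a \<Rightarrow> real) \<Rightarrow> (real \<Rightarrow> 'a \<Rightarrow> real) \<Rightarrow> bool" where
  "indep_processes I M X Y \<longleftrightarrow>
     prob_space.indep_var M
       (PiM I (\<lambda>_. borel)) (\<lambda>\<omega>. \<lambda>t\<in>I. X t \<omega>)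
       (PiM I (\<lambda>_. borel)) (\<lambda>\<omega>. \<lambda>t\<in>I. Y t \<omega>)"

(* Equality of laws of random variables that may live on different probability spaces.
   The completions are needed because paths are only almost surely continuous, so that a
   supremum over uncountably many times is measurable only up to null sets.  For X and Y that are
   measurable with respect to M and N these are the laws under M and N themselves. *)
definition eq_in_distr ::
  "'a measure \<Rightarrow> ('a \<Rightarrow> 'c::topological_space) \<Rightarrow> 'b measure \<Rightarrow> ('b \<Rightarrow> 'c) \<Rightarrow> bool" where
  "eq_in_distr M X N Y \<longleftrightarrow>
     X \<in> borel_measurable (completion M) \<and>
     Y \<in> borel_measurable (completion N) \<and>
     distr (completion M) borel X = distr (completion N) borel Y"

definition bridge_norm :: "(real \<Rightarrow> 'a \<Rightarrow> real) \<Rightarrow> 'a \<Rightarrow> real" where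
  "bridge_norm X \<omega> = sqrt (LBINT u:{0..1}. (X u \<omega> - u * X 1 \<omega>)\<^sup>2)"

(* Values are taken in [0, \<infinity>], so that the supremum is the true one even where it is infinite.
   All quantities under ennreal are nonnegative, so nothing is truncated. *)
definition G_stat :: "(real \<Rightarrow> real) \<Rightarrow> (real \<Rightarrow> 'a \<Rightarrow> real) \<Rightarrow> 'a \<Rightarrow> ennreal" where
  "G_stat g B \<omega> =
     1 / ennreal (bridge_norm B \<omega>) *
     (SUP \<tau>\<in>{1..}. SUP r\<in>{1..\<tau>}. ennreal (\<bar>B r \<omega> - r / \<tau> * B \<tau> \<omega>\<bar> / g \<tau>))"

end

theory Submission
  imports Defs
begin

text \<open>Put \<open>X t = t * B (1 / t)\<close>. Substituting \<open>t = 1 / \<tau>\<close> and \<open>v = 1 / r\<close> turns the supremum in the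
  statistic, path by path, into the supremum of \<open>\<bar>X v - X t\<bar> / (v * g (1 / t))\<close>. The process \<open>X\<close> on
  \<open>(0, 1]\<close> is a Brownian motion, and it is uncorrelated with the bridge \<open>B u - u * B 1\<close> on \<open>[0, 1]\<close>
  because it only involves \<open>B\<close> on \<open>[1, \<infinity>)\<close>. Both families being jointly Gaussian, they have the same
  joint law as \<open>W\<close> and the bridge of \<open>W0\<close>. Equality of the joint laws is read off the
  characteristic functions of finite linear combinations, and path continuity expresses the statistic
  by countably many coordinates.\<close>

subsection \<open>Uniqueness of joint characteristic functions\<close>

lemma (in finite_measure) integrable_iexp_bounded:
  fixes h :: "'a \<Rightarrow> real"
  assumes [measurable]: "f \<in> borel_measurable M" "h \<in> borel_measurable M"
    and h: "\<And>x. \<bar>h x\<bar> \<le> b"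
  shows "integrable M (\<lambda>x. h x *\<^sub>R iexp (f x))"
  by (rule integrable_const_bound[of _ b]) (auto simp: h norm_mult)

text \<open>Frequency 0 compares the total masses. If the common mass \<open>c\<close> is 0, both
  measures vanish; otherwise division by \<open>c\<close> gives probability measures, to which
  Levy's uniqueness theorem applies.\<close>

lemma finite_measure_eqI_char:
  fixes \<mu> \<nu> :: "real measure"
  assumes "finite_measure \<mu>" "finite_measure \<nu>"
    and sets [simp, measurable_cong]: "sets \<mu> = sets borel" "sets \<nu> = sets borel"
    and eq: "\<And>t. (CLINT x|\<mu>. iexp (t * x)) = (CLINT x|\<nu>. iexp (t * x))"
  shows "\<mu> = \<nu>"
proof -
  interpret \<mu>: finite_measure \<mu> by fact
  interpret \<nu>: finite_measure \<nu> by fact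
  have [simp]: "space \<mu> = UNIV" "space \<nu> = UNIV"
    using sets[THEN sets_eq_imp_space_eq] by simp_all
  define c where "c = measure \<mu> UNIV"
  have c: "c = measure \<nu> UNIV"
    using eq[of 0] by (simp add: c_def)
  show ?thesis
  proof (cases "c = 0")
    case True
    show ?thesis
    proof (rule measure_eqI)
      fix A assume "A \<in> sets \<mu>"
      have "emeasure \<mu> A \<le> emeasure \<mu> UNIV" "emeasure \<nu> A \<le> emeasure \<nu> UNIV"
        by (auto intro!: emeasure_mono)
      then show "emeasure \<mu> A = emeasure \<nu> A"
        using True c by (simp add: c_def \<mu>.emeasure_eq_measure \<nu>.emeasure_eq_measure measure_le_0_iff)
    qed simp
  next
    case False
    then have cpos: "c > 0" by (simp add: c_def zero_less_measure_iff)
    let ?S = "\<lambda>\<mu>::real measure. density \<mu> (\<lambda>_. ennreal (1 / c))"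
    have dist: "real_distribution (?S \<mu>)" "real_distribution (?S \<nu>)"
      using cpos
      by (auto intro!: real_distribution.intro prob_spaceI simp: real_distribution_axioms_def
        emeasure_density_const \<mu>.emeasure_eq_measure \<nu>.emeasure_eq_measure
        c_def[symmetric] c[symmetric] ennreal_mult[symmetric])
    have "char (?S \<mu>) = char (?S \<nu>)"
      using cpos by (intro ext) (simp add: char_def integral_density eq[unfolded of_real_mult])
    then have *: "?S \<mu> = ?S \<nu>"
      by (rule Levy_uniqueness[OF dist])
    show ?thesis
    proof (rule measure_eqI)
      fix A assume "A \<in> sets \<mu>"
      then have "ennreal (1 / c) * emeasure \<mu> A = ennreal (1 / c) * emeasure \<nu> A"
        using arg_cong[OF *, of "\<lambda>M. emeasure M A"] by (simp add: emeasure_density_const)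
      then have "(1 / c) * measure \<mu> A = (1 / c) * measure \<nu> A"
        using cpos by (simp add: \<mu>.emeasure_eq_measure \<nu>.emeasure_eq_measure ennreal_mult[symmetric])
      then show "emeasure \<mu> A = emeasure \<nu> A"
        using cpos by (simp add: \<mu>.emeasure_eq_measure \<nu>.emeasure_eq_measure)
    qed simp
  qed
qed

text \<open>Trades the exponential in one coordinate for an indicator and keeps the exponential of
  the remaining ones. With it, joint laws can be identified one coordinate at a time from uniqueness
  on the real line.\<close>

lemma integral_indicator_iexp_eqI:
  fixes X \<theta> :: "'a \<Rightarrow> real" and Y \<eta> :: "'b \<Rightarrow> real"
  assumes "finite_measure M" "finite_measure N"
    and [measurable]: "X \<in> borel_measurable M" "\<theta> \<in> borel_measurable M"
      "Y \<in> borel_measurable N" "\<eta> \<in> borel_measurable N" "A \<in> sets borel"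
    and eq: "\<And>t u. (CLINT x|M. iexp (t * X x + u * \<theta> x)) = (CLINT x|N. iexp (t * Y x + u * \<eta> x))"
  shows "(CLINT x|M. indicator A (X x) *\<^sub>R iexp (\<theta> x)) = (CLINT x|N. indicator A (Y x) *\<^sub>R iexp (\<eta> x))"
proof -
  interpret M: finite_measure M by fact
  interpret N: finite_measure N by fact
  \<comment> \<open>By Euler's formula a cosine weight only shifts the frequency of
    \<open>\<theta>\<close>, so \<open>eq\<close> is called upon at \<open>u = 0\<close>,
    \<open>u = 1\<close> and \<open>u = -1\<close>.\<close>
  have iexp_cos: "complex_of_real (1 + cos (\<theta> + a)) * iexp x =
      iexp x + iexp a / 2 * iexp (x + \<theta>) + iexp (- a) / 2 * iexp (x - \<theta>)" for a \<theta> x :: real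
    by (simp add: cos_of_real[symmetric] cos_exp_eq exp_add[symmetric] field_simps exp_diff exp_minus)
  have iM: "integrable M (\<lambda>x. iexp (f x))" if [measurable]: "f \<in> borel_measurable M" for f
    using M.integrable_iexp_bounded[OF that, of "\<lambda>_. 1" 1] by simp
  have iN: "integrable N (\<lambda>x. iexp (f x))" if [measurable]: "f \<in> borel_measurable N" for f
    using N.integrable_iexp_bounded[OF that, of "\<lambda>_. 1" 1] by simp
  \<comment> \<open>The weights \<open>1 + cos (\<theta> + a)\<close> are nonnegative, so that the uniqueness theorem for
    positive measures applies to them, and they span \<open>1\<close>, \<open>cos \<theta>\<close> and \<open>sin \<theta>\<close>.\<close>
  have weight: "(LINT x|M. indicator A (X x) * (1 + cos (\<theta> x + a))) =
      (LINT x|N. indicator A (Y x) * (1 + cos (\<eta> x + a)))" for a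
  proof -
    define h where "h x = 1 + cos (\<theta> x + a)" for x
    define k where "k x = 1 + cos (\<eta> x + a)" for x
    have h0: "0 \<le> h x" "\<bar>h x\<bar> \<le> 2" "h x \<le> 2" for x
      unfolding h_def using cos_ge_minus_one[of "\<theta> x + a"] cos_le_one[of "\<theta> x + a"] by linarith+
    have k0: "0 \<le> k x" "\<bar>k x\<bar> \<le> 2" "k x \<le> 2" for x
      unfolding k_def using cos_ge_minus_one[of "\<eta> x + a"] cos_le_one[of "\<eta> x + a"] by linarith+
    have [measurable]: "h \<in> borel_measurable M" "k \<in> borel_measurable N"
      by (simp_all add: h_def[abs_def] k_def[abs_def])
    have hM: "integrable M h" and kN: "integrable N k"
      using h0 k0 by (auto intro!: M.integrable_const_bound[of _ 2] N.integrable_const_bound[of _ 2])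
    have fin: "finite_measure (density M h)" "finite_measure (density N k)"
      using h0 k0 hM kN
      by (auto intro!: finite_measureI simp: emeasure_density nn_integral_eq_integral)
    interpret H: finite_measure "density M h" by fact
    interpret K: finite_measure "density N k" by fact
    have "distr (density M h) borel X = distr (density N k) borel Y"
    proof (rule finite_measure_eqI_char)
      fix t
      have "(CLINT x|distr (density M h) borel X. iexp (t * x)) = (CLINT x|M. h x *\<^sub>R iexp (t * X x))"
        by (simp add: integral_distr integral_density h0)
      also have "\<dots> = (CLINT x|M. iexp (t * X x + 0 * \<theta> x) + iexp a / 2 * iexp (t * X x + 1 * \<theta> x)
          + iexp (- a) / 2 * iexp (t * X x + (-1) * \<theta> x))"
        by (intro Bochner_Integration.integral_cong refl)
          (use iexp_cos[of "\<theta> x" a "t * X x" for x] in \<open>simp add: h_def scaleR_conv_of_real algebra_simps\<close>)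
      also have "\<dots> = (CLINT x|M. iexp (t * X x + 0 * \<theta> x))
          + iexp a / 2 * (CLINT x|M. iexp (t * X x + 1 * \<theta> x))
          + iexp (- a) / 2 * (CLINT x|M. iexp (t * X x + (-1) * \<theta> x))"
        by (subst Bochner_Integration.integral_add integral_mult_right_zero;
          (intro Bochner_Integration.integrable_add integrable_mult_right iM; measurable)?)+ simp
      also have "\<dots> = (CLINT x|N. iexp (t * Y x + 0 * \<eta> x))
          + iexp a / 2 * (CLINT x|N. iexp (t * Y x + 1 * \<eta> x))
          + iexp (- a) / 2 * (CLINT x|N. iexp (t * Y x + (-1) * \<eta> x))"
        by (simp only: eq)
      also have "\<dots> = (CLINT x|N. iexp (t * Y x + 0 * \<eta> x) + iexp a / 2 * iexp (t * Y x + 1 * \<eta> x)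
          + iexp (- a) / 2 * iexp (t * Y x + (-1) * \<eta> x))"
        by (subst Bochner_Integration.integral_add integral_mult_right_zero;
          (intro Bochner_Integration.integrable_add integrable_mult_right iN; measurable)?)+ simp
      also have "\<dots> = (CLINT x|N. k x *\<^sub>R iexp (t * Y x))"
        by (intro Bochner_Integration.integral_cong refl)
          (use iexp_cos[of "\<eta> x" a "t * Y x" for x] in \<open>simp add: k_def scaleR_conv_of_real algebra_simps\<close>)
      also have "\<dots> = (CLINT x|distr (density N k) borel Y. iexp (t * x))"
        by (simp add: integral_distr integral_density k0)
      finally show "(CLINT x|distr (density M h) borel X. iexp (t * x)) =
        (CLINT x|distr (density N k) borel Y. iexp (t * x))" .
    qed (auto intro!: H.finite_measure_distr K.finite_measure_distr)
    then have "(LINT x|distr (density M h) borel X. indicator A x) =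
        (LINT x|distr (density N k) borel Y. indicator A x :: real)" by simp
    then show ?thesis
      by (simp add: integral_distr integral_density h0 k0 mult.commute h_def[symmetric] k_def[symmetric]
        del: Bochner_Integration.integral_indicator)
  qed
  have cos_bound: "\<bar>1 + cos y\<bar> \<le> 2" for y :: real
    using cos_ge_minus_one[of y] cos_le_one[of y] by linarith
  have fM: "integrable M (\<lambda>x. indicator A (X x) * (1 + cos (\<theta> x + a)))" for a
    by (rule M.integrable_const_bound[of _ 2]) (auto simp: indicator_def cos_bound)
  have fN: "integrable N (\<lambda>x. indicator A (Y x) * (1 + cos (\<eta> x + a)))" for a
    by (rule N.integrable_const_bound[of _ 2]) (auto simp: indicator_def cos_bound)
  \<comment> \<open>The shifts \<open>0\<close>, \<open>- pi / 2\<close> and \<open>pi\<close> give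
    the weights \<open>1 + cos v\<close>, \<open>1 + sin v\<close> and \<open>1 - cos v\<close>. The
    first plus \<open>\<i>\<close> times the second exceeds \<open>iexp v\<close> by
    \<open>1 + \<i>\<close>, and half the sum of the first and third is 1.\<close>
  have dec: "indicator A z *\<^sub>R iexp v = complex_of_real (indicator A z * (1 + cos (v + 0)))
     + \<i> * complex_of_real (indicator A z * (1 + cos (v + (- pi / 2))))
     - (1 + \<i>) / 2 * (complex_of_real (indicator A z * (1 + cos (v + 0)))
       + complex_of_real (indicator A z * (1 + cos (v + pi))))" for z v :: real
    by (simp add: complex_eq_iff indicator_def cos_add sin_add cos_diff Re_exp Im_exp)
  have "(CLINT x|M. indicator A (X x) *\<^sub>R iexp (\<theta> x)) =
     complex_of_real (LINT x|M. indicator A (X x) * (1 + cos (\<theta> x + 0)))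
     + \<i> * complex_of_real (LINT x|M. indicator A (X x) * (1 + cos (\<theta> x + (- pi / 2))))
     - (1 + \<i>) / 2 * (complex_of_real (LINT x|M. indicator A (X x) * (1 + cos (\<theta> x + 0)))
       + complex_of_real (LINT x|M. indicator A (X x) * (1 + cos (\<theta> x + pi))))"
    unfolding dec
    by (subst Bochner_Integration.integral_add Bochner_Integration.integral_diff
        integral_mult_right_zero integral_complex_of_real;
      (intro Bochner_Integration.integrable_add Bochner_Integration.integrable_diff
        integrable_mult_right integrable_of_real fM)?)+ simp
  also have "\<dots> =
     complex_of_real (LINT x|N. indicator A (Y x) * (1 + cos (\<eta> x + 0)))
     + \<i> * complex_of_real (LINT x|N. indicator A (Y x) * (1 + cos (\<eta> x + (- pi / 2))))
     - (1 + \<i>) / 2 * (complex_of_real (LINT x|N. indicator A (Y x) * (1 + cos (\<eta> x + 0)))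
       + complex_of_real (LINT x|N. indicator A (Y x) * (1 + cos (\<eta> x + pi))))"
    by (simp only: weight)
  also have "\<dots> = (CLINT x|N. indicator A (Y x) *\<^sub>R iexp (\<eta> x))"
    unfolding dec
    by (subst Bochner_Integration.integral_add Bochner_Integration.integral_diff
        integral_mult_right_zero integral_complex_of_real;
      (intro Bochner_Integration.integrable_add Bochner_Integration.integrable_diff
        integrable_mult_right integrable_of_real fN)?)+ simp
  finally show ?thesis .
qed

text \<open>Induction on \<open>J\<close>: restricting both measures to the event that coordinate
  \<open>j\<close> lies in \<open>A j\<close> preserves the hypothesis for the other coordinates.
  The restricted measures need not have mass 1, hence the formulation for arbitrary finite
  measures.\<close>

lemma emeasure_joint_eqI_char:
  fixes X :: "'i \<Rightarrow> 'a \<Rightarrow> real" and Y :: "'i \<Rightarrow> 'b \<Rightarrow> real"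
  assumes "finite J" "finite_measure M" "finite_measure N"
    and "\<And>j. j \<in> J \<Longrightarrow> X j \<in> borel_measurable M" "\<And>j. j \<in> J \<Longrightarrow> Y j \<in> borel_measurable N"
    and "\<And>j. j \<in> J \<Longrightarrow> A j \<in> sets borel"
    and "\<And>s. (CLINT x|M. iexp (\<Sum>j\<in>J. s j * X j x)) = (CLINT x|N. iexp (\<Sum>j\<in>J. s j * Y j x))"
  shows "emeasure M {x\<in>space M. \<forall>j\<in>J. X j x \<in> A j} = emeasure N {x\<in>space N. \<forall>j\<in>J. Y j x \<in> A j}"
  using assms
proof (induction J arbitrary: M N rule: finite_induct)
  case empty
  interpret M: finite_measure M by fact
  interpret N: finite_measure N by fact
  \<comment> \<open>The empty sum makes the exponential 1, so the hypothesis compares total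
    masses.\<close>
  show ?case
    using empty.prems(6) by (simp add: M.emeasure_eq_measure N.emeasure_eq_measure)
next
  case (insert j J)
  interpret M: finite_measure M by fact
  interpret N: finite_measure N by fact
  note [measurable] = insert.prems(3-5)
  define M' where "M' = density M (\<lambda>x. ennreal (indicator (A j) (X j x)))"
  define N' where "N' = density N (\<lambda>x. ennreal (indicator (A j) (Y j x)))"
  have [measurable_cong, simp]: "sets M' = sets M" "sets N' = sets N"
    by (simp_all add: M'_def N'_def)
  have [simp]: "space M' = space M" "space N' = space N"
    by (simp_all add: M'_def N'_def)
  have fin: "finite_measure M'" "finite_measure N'"
    unfolding M'_def N'_def
    by (auto intro!: finite_measureI simp: emeasure_density 
       order.strict_implies_not_eq[OF le_less_trans[OF nn_integral_mono[of _ _ "\<lambda>_. 1"]]]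
       indicator_def less_top[symmetric])
  have [measurable]: "X i \<in> borel_measurable M'" "Y i \<in> borel_measurable N'" if "i \<in> J" for i
    using that by auto
  have "(CLINT x|M'. iexp (\<Sum>i\<in>J. s i * X i x)) = (CLINT x|N'. iexp (\<Sum>i\<in>J. s i * Y i x))" for s
  proof -
    have [measurable]: "(\<lambda>x. \<Sum>i\<in>J. s i * X i x) \<in> borel_measurable M"
      "(\<lambda>x. \<Sum>i\<in>J. s i * Y i x) \<in> borel_measurable N"
      "X j \<in> borel_measurable M" "Y j \<in> borel_measurable N" "A j \<in> sets borel"
      by auto
    have "(CLINT x|M. indicator (A j) (X j x) *\<^sub>R iexp (\<Sum>i\<in>J. s i * X i x)) =
       (CLINT x|N. indicator (A j) (Y j x) *\<^sub>R iexp (\<Sum>i\<in>J. s i * Y i x))"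
    proof (rule integral_indicator_iexp_eqI[OF insert.prems(1,2)])
      fix t u :: real
      \<comment> \<open>The two frequencies are merged into one coefficient vector on
        \<open>insert j J\<close>, to which the hypothesis for all \<open>s\<close> applies.\<close>
      have *: "t * Z j x + u * (\<Sum>i\<in>J. s i * Z i x) = 
        (\<Sum>i\<in>insert j J. (if i = j then t else u * s i) * Z i x)" for Z :: "'i \<Rightarrow> 'z \<Rightarrow> real" and x
        using insert.hyps by (auto simp: sum_distrib_left mult.assoc intro!: sum.cong)
      show "(CLINT x|M. iexp (t * X j x + u * (\<Sum>i\<in>J. s i * X i x))) =
        (CLINT x|N. iexp (t * Y j x + u * (\<Sum>i\<in>J. s i * Y i x)))"
        unfolding * by (rule insert.prems(6))
    qed measurable
    then show ?thesis
      by (simp add: M'_def N'_def integral_density)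
  qed
  then have step: "emeasure M' {x\<in>space M'. \<forall>i\<in>J. X i x \<in> A i} = emeasure N' {x\<in>space N'. \<forall>i\<in>J. Y i x \<in> A i}"
    by (intro insert.IH fin) auto
  have dens: "emeasure (density L (\<lambda>x. ennreal (indicator (A j) (Z j x)))) {x\<in>space L. \<forall>i\<in>J. Z i x \<in> A i} =
      emeasure L {x\<in>space L. \<forall>i\<in>insert j J. Z i x \<in> A i}"
    if Z: "\<And>i. i \<in> insert j J \<Longrightarrow> Z i \<in> borel_measurable L" for Z :: "'i \<Rightarrow> 'z \<Rightarrow> real" and L
  proof -
    note [measurable] = Z
    have [measurable]: "Z j \<in> borel_measurable L" "A j \<in> sets borel" by auto
    have ZA: "{x\<in>space L. Z i x \<in> A i} \<in> sets L" if "i \<in> insert j J" for i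
      using Z[OF that] insert.prems(5)[OF that] by measurable
    have S [measurable]: "{x\<in>space L. \<forall>i\<in>J. Z i x \<in> A i} \<in> sets L"
      "{x\<in>space L. \<forall>i\<in>insert j J. Z i x \<in> A i} \<in> sets L"
      using insert.hyps ZA by (auto intro!: sets.sets_Collect_finite_All)
    have "emeasure (density L (\<lambda>x. ennreal (indicator (A j) (Z j x)))) {x\<in>space L. \<forall>i\<in>J. Z i x \<in> A i} =
      (\<integral>\<^sup>+x. indicator {x\<in>space L. \<forall>i\<in>insert j J. Z i x \<in> A i} x \<partial>L)"
      by (subst emeasure_density, measurable)
        (auto intro!: nn_integral_cong simp: indicator_def simp del: nn_integral_indicator)
    then show ?thesis by (simp only: nn_integral_indicator[OF S(2)])
  qed
  show ?case
    using step dens[of X M, OF insert.prems(3)] dens[of Y N, OF insert.prems(4)]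
    by (simp add: M'_def N'_def)
qed

text \<open>Cylinder sets over finite \<open>J\<close> determine a finite measure on the product
  space, and the preimage of such a set is an event about finitely many coordinates.\<close>

lemma distr_PiM_eqI_char:
  fixes X :: "'i \<Rightarrow> 'a \<Rightarrow> real" and Y :: "'i \<Rightarrow> 'b \<Rightarrow> real"
  assumes "finite_measure M" "finite_measure N"
    and X [measurable]: "\<And>i. i \<in> I \<Longrightarrow> X i \<in> borel_measurable M"
    and Y [measurable]: "\<And>i. i \<in> I \<Longrightarrow> Y i \<in> borel_measurable N"
    and eq: "\<And>J s. finite J \<Longrightarrow> J \<subseteq> I \<Longrightarrow>
      (CLINT x|M. iexp (\<Sum>j\<in>J. s j * X j x)) = (CLINT x|N. iexp (\<Sum>j\<in>J. s j * Y j x))"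
  shows "distr M (PiM I (\<lambda>_. borel)) (\<lambda>x. \<lambda>i\<in>I. X i x) = distr N (PiM I (\<lambda>_. borel)) (\<lambda>x. \<lambda>i\<in>I. Y i x)"
proof (rule measure_eqI_PiM_infinite)
  interpret M: finite_measure M by fact
  show "finite_measure (distr M (PiM I (\<lambda>_. borel)) (\<lambda>x. \<lambda>i\<in>I. X i x))"
    by (intro M.finite_measure_distr) measurable
  fix A :: "'i \<Rightarrow> real set" and J
  assume J: "finite J" "J \<subseteq> I" and A: "\<And>j. j \<in> J \<Longrightarrow> A j \<in> sets borel"
  have [measurable]: "prod_emb I (\<lambda>_. borel) J (Pi\<^sub>E J A) \<in> sets (PiM I (\<lambda>_. borel))"
    using J A by (intro sets_PiM_I) auto
  have pre: "(\<lambda>x. \<lambda>i\<in>I. Z i x) -` prod_emb I (\<lambda>_. borel) J (Pi\<^sub>E J A) \<inter> S = {x\<in>S. \<forall>j\<in>J. Z j x \<in> A j}"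
    for Z :: "'i \<Rightarrow> 'z \<Rightarrow> real" and S
    using J by (auto simp: prod_emb_def PiE_iff space_PiM) (metis subsetD)
  show "emeasure (distr M (PiM I (\<lambda>_. borel)) (\<lambda>x. \<lambda>i\<in>I. X i x)) (prod_emb I (\<lambda>_. borel) J (Pi\<^sub>E J A)) =
    emeasure (distr N (PiM I (\<lambda>_. borel)) (\<lambda>x. \<lambda>i\<in>I. Y i x)) (prod_emb I (\<lambda>_. borel) J (Pi\<^sub>E J A))"
    by (subst (1 2) emeasure_distr, measurable, unfold pre)
      (rule emeasure_joint_eqI_char[OF J(1) assms(1,2)], use J A X Y eq in auto)
qed auto

subsection \<open>Characteristic functions of Brownian motion\<close>

text \<open>Dividing by \<open>\<sigma>\<close> gives a standard normal variable, whose
  characteristic function is taken at \<open>c * \<sigma>\<close>.\<close>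

lemma (in prob_space) integral_iexp_normal:
  assumes X: "distributed M lborel X (\<lambda>x. ennreal (normal_density 0 \<sigma> x))" and \<sigma>: "0 < \<sigma>"
  shows "(CLINT \<omega>|M. iexp (c * X \<omega>)) = complex_of_real (exp (- (c\<^sup>2 * \<sigma>\<^sup>2) / 2))"
proof -
  have S: "distributed M lborel (\<lambda>\<omega>. X \<omega> / \<sigma>) (\<lambda>x. ennreal (std_normal_density x))"
    using normal_standard_normal_convert[OF \<sigma>, of X 0] X by simp
  then have [measurable]: "(\<lambda>\<omega>. X \<omega> / \<sigma>) \<in> borel_measurable M"
    by (simp add: distributed_def)
  have "(CLINT \<omega>|M. iexp (c * X \<omega>)) = (CLINT \<omega>|M. iexp ((c * \<sigma>) * (X \<omega> / \<sigma>)))"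
    using \<sigma> by (intro Bochner_Integration.integral_cong) auto
  also have "\<dots> = (CLINT x|distr M lborel (\<lambda>\<omega>. X \<omega> / \<sigma>). iexp ((c * \<sigma>) * x))"
    by (subst integral_distr) auto
  also have "\<dots> = char std_normal_distribution (c * \<sigma>)"
    using S by (simp add: distributed_distr_eq_density char_def)
  finally show ?thesis
    by (simp add: char_std_normal_distribution power_mult_distrib)
qed

text \<open>Independence of increments is stated along an ordered sequence of times, whereas a
  linear combination provides only a finite set of them.\<close>

lemma strict_mono_enumeration:
  fixes T :: "'a::linorder set"
  assumes "finite T" "T \<noteq> {}"
  obtains n t where "t ` {..n::nat} = T" "\<And>i j. i \<le> n \<Longrightarrow> j \<le> n \<Longrightarrow> t i < t j \<longleftrightarrow> i < j" "t 0 = Min T"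
proof -
  define L where "L = sorted_list_of_set T"
  have L: "set L = T" "sorted_wrt (<) L" "L \<noteq> []"
    using assms by (auto simp: L_def)
  have lt: "L ! i < L ! j \<longleftrightarrow> i < j" if "i < length L" "j < length L" for i j
    using sorted_wrt_nth_less[OF L(2)] that by (metis less_asym' linorder_neqE_nat order_less_irrefl)
  have im: "(!) L ` {..length L - 1} = T"
  proof -
    have "{..length L - 1} = {..<length L}"
      using L(3) by (auto simp: neq_Nil_conv)
    then show ?thesis
      using L(1) by (auto simp: set_conv_nth)
  qed
  have L0: "L ! 0 = Min T"
  proof (rule Min_eqI[symmetric])
    fix y assume "y \<in> T"
    then obtain i where "y = L ! i" "i < length L"
      using L(1) by (auto simp: in_set_conv_nth)
    then show "L ! 0 \<le> y"
      using lt[of i 0] L(3) by (metis leI length_greater_0_conv not_less_zero)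
  qed (use L assms in auto)
  have len: "k \<le> length L - 1 \<longleftrightarrow> k < length L" for k
    using L(3) by (cases L) auto
  show thesis
    by (rule that[of "(!) L" "length L - 1"]) (use im lt len L0 in simp_all)
qed

text \<open>Since \<open>x = t k\<close> for some \<open>k\<close>, the condition
  \<open>t i < x\<close> cuts the sum at \<open>k\<close>, and the rest telescopes. It serves both
  for a path and, with the identity as \<open>f\<close>, for the variances.\<close>

lemma sum_increments_below:
  fixes f :: "'a::linorder \<Rightarrow> real"
  assumes "\<And>i j. i \<le> n \<Longrightarrow> j \<le> n \<Longrightarrow> t i < t j \<longleftrightarrow> i < j" and x: "x \<in> t ` {..n::nat}"
  shows "(\<Sum>i<n. of_bool (t i < x) * (f (t (Suc i)) - f (t i))) = f x - f (t 0)"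
proof -
  obtain k where k: "k \<le> n" "x = t k" using x by auto
  have "(\<Sum>i<n. of_bool (t i < x) * (f (t (Suc i)) - f (t i))) = (\<Sum>i<k. f (t (Suc i)) - f (t i))"
    using k assms(1) by (intro sum.mono_neutral_cong_right) auto
  also have "\<dots> = f (t k) - f (t 0)"
    by (rule sum_lessThan_telescope)
  finally show ?thesis
    by (simp only: k)
qed

text \<open>The linear combination is rewritten as a sum of independent normal increments
  \<open>D i\<close> with weights \<open>C i\<close>. The variance of that sum, expanded in the
  original coefficients, has the Brownian covariance \<open>min\<close> as its kernel.\<close>

lemma brownian_char:
  assumes B: "std_brownian_motion I M B" and I: "I \<subseteq> {0..}" "0 \<in> I"
    and J: "finite J" and x: "\<And>j. j \<in> J \<Longrightarrow> x j \<in> I"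
  shows "(CLINT \<omega>|M. iexp (\<Sum>j\<in>J. c j * B (x j) \<omega>)) =
    complex_of_real (exp (- (\<Sum>j\<in>J. \<Sum>k\<in>J. c j * c k * min (x j) (x k)) / 2))"
proof -
  interpret prob_space M using B by (simp add: std_brownian_motion_def)
  have [measurable]: "t \<in> I \<Longrightarrow> B t \<in> borel_measurable M" for t
    using B by (simp add: std_brownian_motion_def)
  \<comment> \<open>Time 0 is added as a starting point, so that each \<open>B (x j)\<close> is
    almost surely the sum of the increments up to \<open>x j\<close>.\<close>
  obtain n t where t: "t ` {..n::nat} = insert 0 (x ` J)"
    and lt: "\<And>i j. i \<le> n \<Longrightarrow> j \<le> n \<Longrightarrow> t i < t j \<longleftrightarrow> i < j" and t0: "t 0 = Min (insert 0 (x ` J))"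
    by (rule strict_mono_enumeration[of "insert 0 (x ` J)"]) (use J in simp_all)
  have t0: "t 0 = 0"
    unfolding t0 using I x J by (intro Min_eqI) auto
  have tI: "t i \<in> I" if "i \<le> n" for i
    using t x I(2) that by (metis (no_types, lifting) image_eqI atMost_iff image_iff insert_iff)
  \<comment> \<open>The increment from \<open>t i\<close> to \<open>t (Suc i)\<close> is part of
    \<open>B (x j)\<close> exactly when \<open>t i < x j\<close>, so it collects the coefficients of
    all such \<open>j\<close>.\<close>
  define C where "C i = (\<Sum>j\<in>J. c j * of_bool (t i < x j))" for i
  define D where "D i \<omega> = B (t (Suc i)) \<omega> - B (t i) \<omega>" for i \<omega>
  have [measurable]: "i < n \<Longrightarrow> D i \<in> borel_measurable M" for i
    unfolding D_def[abs_def] using tI by simp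
  have xt: "x j \<in> t ` {..n}" if "j \<in> J" for j
    using t that by auto
  have "\<forall>i\<le>n. t i \<in> I" "\<forall>i<n. t i \<le> t (Suc i)"
    using tI lt by (auto simp: less_imp_le)
  then have "indep_vars (\<lambda>_. borel) D {..<n}"
    using B unfolding D_def[abs_def] std_brownian_motion_def by blast
  then have indep: "indep_vars (\<lambda>_. borel) (\<lambda>i \<omega>. C i * D i \<omega>) {..<n}"
    by (rule indep_vars_compose2[where Y = "\<lambda>i x. C i * x"]) auto
  have charD: "char (distr M borel (\<lambda>\<omega>. C i * D i \<omega>)) 1 =
      complex_of_real (exp (- ((C i)\<^sup>2 * (t (Suc i) - t i)) / 2))" if "i < n" for i
  proof -
    have i: "t i < t (Suc i)" "t i \<in> I" "t (Suc i) \<in> I"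
      using lt tI that by auto
    then have "distributed M lborel (D i) (\<lambda>x. ennreal (normal_density 0 (sqrt (t (Suc i) - t i)) x))"
      using B unfolding D_def[abs_def] std_brownian_motion_def by blast
    from integral_iexp_normal[OF this] i that show ?thesis
      by (simp add: char_def integral_distr)
  qed
  have "AE \<omega> in M. B 0 \<omega> = 0"
    using B by (simp add: std_brownian_motion_def)
  then have eq: "AE \<omega> in M. (\<Sum>j\<in>J. c j * B (x j) \<omega>) = (\<Sum>i<n. C i * D i \<omega>)"
  proof eventually_elim
    case (elim \<omega>)
    have "(\<Sum>j\<in>J. c j * B (x j) \<omega>) =
        (\<Sum>j\<in>J. c j * (\<Sum>i<n. of_bool (t i < x j) * (B (t (Suc i)) \<omega> - B (t i) \<omega>)))"
      using sum_increments_below[where f="\<lambda>s. B s \<omega>" and t=t and n=n] lt xt elim t0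
      by (intro sum.cong) auto
    also have "\<dots> = (\<Sum>i<n. C i * D i \<omega>)"
      unfolding C_def D_def sum_distrib_left sum_distrib_right
      by (subst sum.swap) (simp add: mult.assoc)
    finally show ?case .
  qed
  have var: "(\<Sum>i<n. (C i)\<^sup>2 * (t (Suc i) - t i)) = (\<Sum>j\<in>J. \<Sum>k\<in>J. c j * c k * min (x j) (x k))"
  proof -
    \<comment> \<open>In the expanded square, the product of the conditions for \<open>j\<close> and
      \<open>k\<close> is the condition for the smaller of the two times. Summed over
      \<open>i\<close>, the interval lengths then telescope to that minimum.\<close>
    have "(\<Sum>i<n. (C i)\<^sup>2 * (t (Suc i) - t i)) =
        (\<Sum>i<n. \<Sum>j\<in>J. \<Sum>k\<in>J. c j * c k * (of_bool (t i < min (x j) (x k)) * (t (Suc i) - t i)))"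
      unfolding C_def power2_eq_square sum_product unfolding sum_distrib_right
      by (intro sum.cong refl) auto
    also have "\<dots> = (\<Sum>j\<in>J. \<Sum>i<n. \<Sum>k\<in>J. c j * c k * (of_bool (t i < min (x j) (x k)) * (t (Suc i) - t i)))"
      by (rule sum.swap)
    also have "\<dots> = (\<Sum>j\<in>J. \<Sum>k\<in>J. \<Sum>i<n. c j * c k * (of_bool (t i < min (x j) (x k)) * (t (Suc i) - t i)))"
      by (intro sum.cong refl sum.swap)
    also have "\<dots> = (\<Sum>j\<in>J. \<Sum>k\<in>J. c j * c k * (min (x j) (x k)))"
      using sum_increments_below[where f="\<lambda>s. s" and t=t and n=n] lt xt t0
      by (intro sum.cong refl) (simp add: sum_distrib_left[symmetric] min_def)
    finally show ?thesis .
  qed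
  have [measurable]: "j \<in> J \<Longrightarrow> B (x j) \<in> borel_measurable M" for j
    using x by simp
  have "(CLINT \<omega>|M. iexp (\<Sum>j\<in>J. c j * B (x j) \<omega>)) = (CLINT \<omega>|M. iexp (\<Sum>i<n. C i * D i \<omega>))"
  proof (rule integral_cong_AE)
    show "AE \<omega> in M. iexp (\<Sum>j\<in>J. c j * B (x j) \<omega>) = iexp (\<Sum>i<n. C i * D i \<omega>)"
      using eq by eventually_elim (simp only:)
  qed measurable
  also have "\<dots> = char (distr M borel (\<lambda>\<omega>. \<Sum>i<n. C i * D i \<omega>)) 1"
    unfolding char_def by (subst integral_distr; (measurable | simp))
  also have "\<dots> = (\<Prod>i<n. complex_of_real (exp (- ((C i)\<^sup>2 * (t (Suc i) - t i)) / 2)))"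
    by (simp add: char_distr_sum[OF indep] charD)
  also have "\<dots> = complex_of_real (exp (\<Sum>i<n. - ((C i)\<^sup>2 * (t (Suc i) - t i)) / 2))"
    by (simp add: exp_sum)
  also have "(\<Sum>i<n. - ((C i)\<^sup>2 * (t (Suc i) - t i)) / 2) = - (\<Sum>i<n. (C i)\<^sup>2 * (t (Suc i) - t i)) / 2"
    by (simp add: sum_negf sum_divide_distrib)
  finally show ?thesis
    by (simp only: var)
qed

text \<open>Covers coordinates that combine two values of the motion, as the bridge does. Indexing
  by \<open>J \<times> UNIV\<close>, with a boolean choosing the first or second value, reduces it
  to \<open>brownian_char\<close>.\<close>

lemma brownian_pair_char:
  assumes B: "std_brownian_motion I M B" and I: "I \<subseteq> {0..}" "0 \<in> I"
    and J: "finite J" and xy: "\<And>j. j \<in> J \<Longrightarrow> x j \<in> I" "\<And>j. j \<in> J \<Longrightarrow> y j \<in> I"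
  shows "(CLINT \<omega>|M. iexp (\<Sum>j\<in>J. s j * (p j * B (x j) \<omega> + q j * B (y j) \<omega>))) =
    complex_of_real (exp (- (\<Sum>j\<in>J. \<Sum>k\<in>J. s j * s k *
      (p j * p k * min (x j) (x k) + p j * q k * min (x j) (y k) +
       q j * p k * min (y j) (x k) + q j * q k * min (y j) (y k))) / 2))"
proof -
  let ?c = "\<lambda>(j, b). s j * (if b then p j else q j)"
  let ?z = "\<lambda>(j, b). if b then x j else y j"
  have sumJ: "(\<Sum>i\<in>J \<times> UNIV. f i) = (\<Sum>j\<in>J. f (j, True) + f (j, False))" for f :: "_ \<Rightarrow> real"
    using sum.cartesian_product[of "\<lambda>j b. f (j, b)" UNIV J] by (simp add: UNIV_bool add.commute)
  have "(CLINT \<omega>|M. iexp (\<Sum>i\<in>J \<times> UNIV. ?c i * B (?z i) \<omega>)) =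
    complex_of_real (exp (- (\<Sum>i\<in>J \<times> UNIV. \<Sum>k\<in>J \<times> UNIV. ?c i * ?c k * min (?z i) (?z k)) / 2))"
    by (rule brownian_char[OF B I]) (use J xy in \<open>auto\<close>)
  moreover have "(\<Sum>i\<in>J \<times> UNIV. ?c i * B (?z i) \<omega>) = (\<Sum>j\<in>J. s j * (p j * B (x j) \<omega> + q j * B (y j) \<omega>))" for \<omega>
    unfolding sumJ by (intro sum.cong refl) (simp add: algebra_simps)
  moreover have "(\<Sum>i\<in>J \<times> UNIV. \<Sum>k\<in>J \<times> UNIV. ?c i * ?c k * min (?z i) (?z k)) =
    (\<Sum>j\<in>J. \<Sum>k\<in>J. s j * s k *
      (p j * p k * min (x j) (x k) + p j * q k * min (x j) (y k) +
       q j * p k * min (y j) (x k) + q j * q k * min (y j) (y k)))"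
    unfolding sumJ sum.distrib[symmetric] by (intro sum.cong refl) (simp add: algebra_simps)
  ultimately show ?thesis by simp
qed

subsection \<open>The statistic as a functional of countably many coordinates\<close>

text \<open>Under the completion, changing a variable on a null set affects neither its
  measurability nor its law. It therefore suffices that both variables agree almost surely with the
  same measurable functional of processes with equal laws.\<close>

lemma eq_in_distrI:
  fixes \<Phi> :: "'p \<Rightarrow> 'c::topological_space"
  assumes \<Phi> [measurable]: "\<Phi> \<in> borel_measurable P"
    and [measurable]: "U \<in> M \<rightarrow>\<^sub>M P" "V \<in> N \<rightarrow>\<^sub>M P"
    and eq: "distr M P U = distr N P V"
    and X: "AE \<omega> in M. X \<omega> = \<Phi> (U \<omega>)" and Y: "AE \<omega> in N. Y \<omega> = \<Phi> (V \<omega>)"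
  shows "eq_in_distr M X N Y"
proof -
  have *: "X \<in> borel_measurable (completion M)" "distr (completion M) borel X = distr (distr M P U) borel \<Phi>"
    if X: "AE \<omega> in M. X \<omega> = \<Phi> (U \<omega>)" and [measurable]: "U \<in> M \<rightarrow>\<^sub>M P" for M :: "'z measure" and X U
  proof -
    have \<Phi>U: "(\<lambda>\<omega>. \<Phi> (U \<omega>)) \<in> borel_measurable (completion M)"
      by (rule measurable_completion) measurable
    have AE: "AE \<omega> in completion M. X \<omega> = \<Phi> (U \<omega>)"
      using X by (rule AE_completion)
    show meas: "X \<in> borel_measurable (completion M)"
    proof (rule measurableI)
      fix A :: "'c set" assume A: "A \<in> sets borel"
      show "X -` A \<inter> space (completion M) \<in> sets (completion M)"
      proof (rule completion.in_sets_AE)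
        show "AE \<omega> in completion M. \<omega> \<in> (\<lambda>\<omega>. \<Phi> (U \<omega>)) -` A \<inter> space (completion M) \<longleftrightarrow>
            \<omega> \<in> X -` A \<inter> space (completion M)"
          using AE by eventually_elim auto
      qed (use measurable_sets[OF \<Phi>U A] in auto)
    qed simp
    have "distr (completion M) borel X = distr (completion M) borel (\<lambda>\<omega>. \<Phi> (U \<omega>))"
      by (rule distr_cong_AE) (use AE meas \<Phi>U in auto)
    also have "\<dots> = distr M borel (\<lambda>\<omega>. \<Phi> (U \<omega>))"
      by (rule distr_completion) measurable
    also have "\<dots> = distr (distr M P U) borel \<Phi>"
      by (simp add: distr_distr comp_def)
    finally show "distr (completion M) borel X = distr (distr M P U) borel \<Phi>" .
  qed
  show ?thesis
    using *[OF X] *[OF Y] eq by (simp add: eq_in_distr_def)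
qed

text \<open>The set of points of \<open>S\<close> where \<open>f\<close> is at most the supremum
  over \<open>D\<close> is relatively closed and contains \<open>D\<close>, hence is all of
  \<open>S\<close>.\<close>

lemma SUP_dense:
  fixes f :: "'a::topological_space \<Rightarrow> 'b::{complete_linorder, linorder_topology}"
  assumes D: "D \<subseteq> S" "S \<subseteq> closure D" and f: "continuous_on S f"
  shows "(SUP x\<in>S. f x) = (SUP x\<in>D. f x)"
proof (rule antisym)
  show "(SUP x\<in>S. f x) \<le> (SUP x\<in>D. f x)"
  proof (rule SUP_least)
    fix x assume x: "x \<in> S"
    have "closedin (top_of_set S) (S \<inter> f -` {..SUP x\<in>D. f x})"
      by (intro continuous_closedin_preimage f closed_atMost)
    then obtain U where U: "closed U" "S \<inter> f -` {..SUP x\<in>D. f x} = S \<inter> U"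
      by (auto simp: closedin_closed)
    have "D \<subseteq> S \<inter> f -` {..SUP x\<in>D. f x}"
      using D by (auto intro: SUP_upper)
    then have "closure D \<subseteq> U"
      using U by (intro closure_minimal) auto
    then show "f x \<le> (SUP x\<in>D. f x)"
      using x D U by auto
  qed
qed (use D in \<open>auto intro: SUP_subset_mono\<close>)

text \<open>Rounds \<open>u\<close> down to a multiple of \<open>1 / n\<close>. For fixed
  \<open>n\<close> it takes countably many values, which makes evaluating a path at
  \<open>grid n u\<close> jointly measurable in path and \<open>u\<close>; the clamping keeps it in
  the index set for every real \<open>u\<close>. For \<open>n = 0\<close> the value is 0, because
  division by zero gives 0.\<close>

definition grid :: "nat \<Rightarrow> real \<Rightarrow> real" where
  "grid n u = max 0 (min 1 (real_of_int \<lfloor>real n * u\<rfloor> / real n))"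

lemma grid_in: "grid n u \<in> {0..1}"
  by (simp add: grid_def)

lemma grid_tendsto:
  assumes "u \<in> {0..1}"
  shows "(\<lambda>n. grid n u) \<longlonglongrightarrow> u"
proof -
  have "(\<lambda>n. real_of_int \<lfloor>real n * u\<rfloor> / real n) \<longlonglongrightarrow> u"
  proof (rule real_tendsto_sandwich)
    show "\<forall>\<^sub>F n in sequentially. u - 1 / real n \<le> real_of_int \<lfloor>real n * u\<rfloor> / real n"
      using eventually_gt_at_top[of 0]
    proof eventually_elim
      case (elim n)
      then have "u - 1 / real n = (real n * u - 1) / real n" by (simp add: field_simps)
      also have "\<dots> \<le> real_of_int \<lfloor>real n * u\<rfloor> / real n"
        by (intro divide_right_mono) linarith+
      finally show ?case .
    qed
    show "\<forall>\<^sub>F n in sequentially. real_of_int \<lfloor>real n * u\<rfloor> / real n \<le> u"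
      using eventually_gt_at_top[of 0] by eventually_elim (simp add: field_simps)
    show "(\<lambda>n. u - 1 / real n) \<longlonglongrightarrow> u"
      using tendsto_diff[OF tendsto_const lim_1_over_n, of u] by simp
  qed simp
  then have "(\<lambda>n. grid n u) \<longlonglongrightarrow> max 0 (min 1 u)"
    unfolding grid_def by (intro tendsto_intros)
  then show ?thesis using assms by simp
qed

text \<open>Reads the statistic off a path whose coordinates \<open>Inl u\<close> are the bridge and whose
  coordinates \<open>Inr t\<close> are the time-inverted motion, using countably many coordinates only.\<close>

definition stat_functional :: "(real \<Rightarrow> real) \<Rightarrow> (real \<times> real) set \<Rightarrow> (real + real \<Rightarrow> real) \<Rightarrow> ennreal" where
  "stat_functional g D y =
     1 / ennreal (sqrt (LBINT u:{0..1}. (lim (\<lambda>n. y (Inl (grid n u))))\<^sup>2)) *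
     (SUP (t, v)\<in>D. ennreal (\<bar>y (Inr v) - y (Inr t)\<bar> / (v * g (1 / t))))"

text \<open>With time 0 left out on the right, the behaviour of \<open>t * B (1 / t)\<close> as
  \<open>t\<close> tends to 0 never enters.\<close>

abbreviation coords :: "(real + real) set" where
  "coords \<equiv> {0..1} <+> {0<..1}"

lemma stat_functional_measurable:
  assumes "countable D" and D: "D \<subseteq> {0<..1} \<times> {0<..1}"
  shows "stat_functional g D \<in> borel_measurable (PiM coords (\<lambda>_. borel))"
proof -
  let ?P = "PiM coords (\<lambda>_. borel) :: (real + real \<Rightarrow> real) measure"
  have [measurable]: "(\<lambda>y. y i) \<in> borel_measurable ?P" if "i \<in> coords" for i
    using that by (rule measurable_component_singleton)
  have SUP: "(\<lambda>y. SUP d\<in>D. ennreal (\<bar>y (Inr (snd d)) - y (Inr (fst d))\<bar> / (snd d * g (1 / fst d))))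
      \<in> borel_measurable ?P"
  proof (rule borel_measurable_SUP[OF assms(1)])
    fix d assume "d \<in> D"
    then have [measurable]: "(\<lambda>y. y (Inr (snd d))) \<in> borel_measurable ?P" "(\<lambda>y. y (Inr (fst d))) \<in> borel_measurable ?P"
      using D by (auto simp: mem_Times_iff intro!: measurable_component_singleton)
    show "(\<lambda>y. ennreal (\<bar>y (Inr (snd d)) - y (Inr (fst d))\<bar> / (snd d * g (1 / fst d)))) \<in> borel_measurable ?P"
      by measurable
  qed
  \<comment> \<open>The grid point depends on \<open>u\<close> only through an integer, and for each
    value of that integer the map is a single coordinate projection.\<close>
  have [measurable]: "(\<lambda>z. fst z (Inl (grid n (snd z)))) \<in> borel_measurable (?P \<Otimes>\<^sub>M lborel)" for n
    unfolding grid_def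
  proof (rule measurable_compose_countable[where
        f = "\<lambda>k z. fst z (Inl (max 0 (min 1 (real_of_int k / real n))))" and g = "\<lambda>z. \<lfloor>real n * snd z\<rfloor>"])
    fix k :: int
    have [measurable]: "(\<lambda>y. y (Inl (max 0 (min 1 (real_of_int k / real n))))) \<in> borel_measurable ?P"
      by (rule measurable_component_singleton) auto
    show "(\<lambda>z. fst z (Inl (max 0 (min 1 (real_of_int k / real n))))) \<in> borel_measurable (?P \<Otimes>\<^sub>M lborel)"
      by measurable
  qed measurable
  have "(\<lambda>y. LBINT u:{0..1}. (lim (\<lambda>n. y (Inl (grid n u))))\<^sup>2) \<in> borel_measurable ?P"
    unfolding set_lebesgue_integral_def
    by (rule lborel.borel_measurable_lebesgue_integral) (simp add: case_prod_unfold, measurable)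
  with SUP show ?thesis
    unfolding stat_functional_def[abs_def] case_prod_unfold by measurable
qed

text \<open>Continuity of \<open>b\<close> makes the values at the grid points converge to
  \<open>b u\<close>. Continuity of the quotient on \<open>R\<close>, where \<open>1 / t\<close> is
  at least 1 and the denominator is positive, extends the supremum from \<open>D\<close> to
  \<open>R\<close>.\<close>

lemma stat_functional_path:
  fixes g :: "real \<Rightarrow> real"
  defines "R \<equiv> {(t, v). 0 < t \<and> t \<le> v \<and> v \<le> 1}"
  assumes g_pos: "\<And>x. 1 \<le> x \<Longrightarrow> 0 < g x" and g: "continuous_on {1..} g"
    and D: "D \<subseteq> R" "R \<subseteq> closure D"
    and b: "continuous_on {0..1} b" and q: "continuous_on {0<..1} q"
    and y: "\<And>u. u \<in> {0..1} \<Longrightarrow> y (Inl u) = b u" "\<And>t. t \<in> {0<..1} \<Longrightarrow> y (Inr t) = q t"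
  shows "stat_functional g D y = 1 / ennreal (sqrt (LBINT u:{0..1}. (b u)\<^sup>2)) *
     (SUP (t, v)\<in>R. ennreal (\<bar>q v - q t\<bar> / (v * g (1 / t))))"
proof -
  have "lim (\<lambda>n. y (Inl (grid n u))) = b u" if u: "u \<in> {0..1}" for u
  proof (rule limI)
    have "(\<lambda>n. b (grid n u)) \<longlonglongrightarrow> b u"
      by (rule continuous_on_tendsto_compose[OF b grid_tendsto[OF u] u]) (use grid_in in auto)
    then show "(\<lambda>n. y (Inl (grid n u))) \<longlonglongrightarrow> b u"
      using y(1)[OF grid_in] by simp
  qed
  then have "(LBINT u:{0..1}. (lim (\<lambda>n. y (Inl (grid n u))))\<^sup>2) = (LBINT u:{0..1}. (b u)\<^sup>2)"
    by (intro set_lebesgue_integral_cong) auto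
  moreover have "(SUP (t, v)\<in>D. ennreal (\<bar>y (Inr v) - y (Inr t)\<bar> / (v * g (1 / t)))) =
      (SUP (t, v)\<in>R. ennreal (\<bar>q v - q t\<bar> / (v * g (1 / t))))"
  proof -
    have "continuous_on R (\<lambda>(t, v). ennreal (\<bar>q v - q t\<bar> / (v * g (1 / t))))"
      unfolding case_prod_unfold
    proof (intro continuous_intros continuous_on_ennreal ballI)
      show "continuous_on R (\<lambda>x. q (snd x))" "continuous_on R (\<lambda>x. q (fst x))"
        by (rule continuous_on_compose2[OF q]; auto intro!: continuous_intros simp: R_def)+
      show "continuous_on R (\<lambda>x. g (1 / fst x))"
        by (rule continuous_on_compose2[OF g]) (auto intro!: continuous_intros simp: R_def)
      fix x assume "x \<in> R"
      then show "snd x * g (1 / fst x) \<noteq> 0"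
        using g_pos[of "1 / fst x"] by (auto simp: R_def)
    qed
    from SUP_dense[OF D this] have "(SUP (t, v)\<in>R. ennreal (\<bar>q v - q t\<bar> / (v * g (1 / t)))) =
      (SUP (t, v)\<in>D. ennreal (\<bar>q v - q t\<bar> / (v * g (1 / t))))" .
    also have "\<dots> = (SUP (t, v)\<in>D. ennreal (\<bar>y (Inr v) - y (Inr t)\<bar> / (v * g (1 / t))))"
    proof (intro SUP_cong refl)
      fix d assume "d \<in> D"
      then have "fst d \<in> {0<..1}" "snd d \<in> {0<..1}"
        using D(1) by (force simp: R_def)+
      then show "(case d of (t, v) \<Rightarrow> ennreal (\<bar>q v - q t\<bar> / (v * g (1 / t)))) =
          (case d of (t, v) \<Rightarrow> ennreal (\<bar>y (Inr v) - y (Inr t)\<bar> / (v * g (1 / t))))"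
        by (simp add: case_prod_unfold y(2))
    qed
    finally show ?thesis by simp
  qed
  ultimately show ?thesis
    by (simp only: stat_functional_def)
qed

text \<open>Inversion sends the pairs with \<open>1 \<le> r \<le> \<tau>\<close> bijectively to
  those with \<open>0 < t \<le> v \<le> 1\<close>. Pulling \<open>1 / v\<close> out of the
  difference produces the factor \<open>v\<close> in the denominator.\<close>

lemma SUP_time_inversion:
  fixes B g :: "real \<Rightarrow> real"
  shows "(SUP \<tau>\<in>{1..}. SUP r\<in>{1..\<tau>}. ennreal (\<bar>B r - r / \<tau> * B \<tau>\<bar> / g \<tau>)) =
    (SUP (t, v)\<in>{(t, v). 0 < t \<and> t \<le> v \<and> v \<le> 1}. ennreal (\<bar>v * B (1 / v) - t * B (1 / t)\<bar> / (v * g (1 / t))))"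
    (is "?L = ?R")
proof -
  have eq: "\<bar>B (1 / v) - (1 / v) / (1 / t) * B (1 / t)\<bar> / g (1 / t) =
      \<bar>v * B (1 / v) - t * B (1 / t)\<bar> / (v * g (1 / t))" if "0 < t" "t \<le> v" for t v
  proof -
    have "B (1 / v) - (1 / v) / (1 / t) * B (1 / t) = (v * B (1 / v) - t * B (1 / t)) / v"
      using that by (simp add: field_simps)
    then show ?thesis
      using that by (simp add: abs_divide)
  qed
  show ?thesis
  proof (rule antisym)
    show "?L \<le> ?R"
    proof (intro SUP_least)
      fix \<tau> r :: real assume "\<tau> \<in> {1..}" "r \<in> {1..\<tau>}"
      then show "ennreal (\<bar>B r - r / \<tau> * B \<tau>\<bar> / g \<tau>) \<le> ?R"
        using eq[of "1 / \<tau>" "1 / r"]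
        by (intro SUP_upper2[of "(1 / \<tau>, 1 / r)"]) (auto simp: field_simps)
    qed
    show "?R \<le> ?L"
    proof (intro SUP_least)
      fix x :: "real \<times> real" assume "x \<in> {(t, v). 0 < t \<and> t \<le> v \<and> v \<le> 1}"
      then obtain t v where x: "x = (t, v)" "0 < t" "t \<le> v" "v \<le> 1" by auto
      have "ennreal (\<bar>B (1 / v) - (1 / v) / (1 / t) * B (1 / t)\<bar> / g (1 / t)) \<le>
          (SUP r\<in>{1..1 / t}. ennreal (\<bar>B r - r / (1 / t) * B (1 / t)\<bar> / g (1 / t)))"
        using x by (intro SUP_upper) (auto simp: field_simps)
      also have "\<dots> \<le> ?L"
        using x by (intro SUP_upper[where i = "1 / t"]) auto
      finally show "(case x of (t, v) \<Rightarrow> ennreal (\<bar>v * B (1 / v) - t * B (1 / t)\<bar> / (v * g (1 / t)))) \<le> ?L"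
        using x by (simp only: eq prod.case)
    qed
  qed
qed

subsection \<open>Time inversion and the bridge\<close>

text \<open>The left side is the covariance of \<open>s * B (1 / s)\<close> and
  \<open>t * B (1 / t)\<close>, so the inverted motion has the covariance of Brownian
  motion.\<close>

lemma inversion_covariance:
  fixes s t :: real
  assumes "0 < s" "0 < t"
  shows "s * t * min (1 / s) (1 / t) = min s t"
  using assms by (auto simp: min_def field_simps)

text \<open>Both families are centred Gaussian with covariance \<open>min u v - u * v\<close> on the left summand,
  \<open>min s t\<close> on the right one, and \<open>0\<close> across.\<close>

lemma bridge_inversion_law:
  assumes B: "std_brownian_motion {0..} M B"
    and W: "std_brownian_motion {0..1} N W"
    and W0: "std_brownian_motion {0..1} N W0"
    and indep: "indep_processes {0..1} N W W0"
  shows "distr M (PiM coords (\<lambda>_. borel))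
       (\<lambda>\<omega>. \<lambda>i\<in>coords. case i of Inl u \<Rightarrow> B u \<omega> - u * B 1 \<omega> | Inr t \<Rightarrow> t * B (1 / t) \<omega>) =
     distr N (PiM coords (\<lambda>_. borel))
       (\<lambda>\<omega>. \<lambda>i\<in>coords. case i of Inl u \<Rightarrow> W0 u \<omega> - u * W0 1 \<omega> | Inr t \<Rightarrow> W t \<omega>)"
proof (rule distr_PiM_eqI_char)
  interpret M: prob_space M using B by (simp add: std_brownian_motion_def)
  interpret N: prob_space N using W by (simp add: std_brownian_motion_def)
  show "finite_measure M" "finite_measure N" by unfold_locales
  have [measurable]: "0 \<le> t \<Longrightarrow> B t \<in> borel_measurable M" for t
    using B by (simp add: std_brownian_motion_def)
  have [measurable]: "0 \<le> t \<Longrightarrow> t \<le> 1 \<Longrightarrow> W t \<in> borel_measurable N"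
     "0 \<le> t \<Longrightarrow> t \<le> 1 \<Longrightarrow> W0 t \<in> borel_measurable N" for t
    using W W0 by (simp_all add: std_brownian_motion_def)
  show "(\<lambda>\<omega>. case i of Inl u \<Rightarrow> B u \<omega> - u * B 1 \<omega> | Inr t \<Rightarrow> t * B (1 / t) \<omega>) \<in> borel_measurable M"
    if "i \<in> coords" for i using that by auto
  show "(\<lambda>\<omega>. case i of Inl u \<Rightarrow> W0 u \<omega> - u * W0 1 \<omega> | Inr t \<Rightarrow> W t \<omega>) \<in> borel_measurable N"
    if "i \<in> coords" for i using that by auto
  fix J :: "(real + real) set" and s :: "real + real \<Rightarrow> real"
  assume J: "finite J" "J \<subseteq> coords"
  \<comment> \<open>Every coordinate built from \<open>B\<close> has the form
    \<open>p * B x + q * B 1\<close>. On the other side it is split into a \<open>W0\<close> part,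
    given by \<open>p0\<close>, \<open>x0\<close>, \<open>q\<close>, and a \<open>W\<close> part,
    given by \<open>p1\<close>, \<open>x1\<close>. A part that is absent has coefficients 0 and the
    placeholder time 0, which is still in the time set.\<close>
  define pB where "pB = (\<lambda>i::real + real. case i of Inl u \<Rightarrow> 1 | Inr t \<Rightarrow> t)"
  define xB where "xB = (\<lambda>i::real + real. case i of Inl u \<Rightarrow> u | Inr t \<Rightarrow> 1 / t)"
  define q where "q = (\<lambda>i::real + real. case i of Inl u \<Rightarrow> - u | Inr t \<Rightarrow> 0)"
  define p0 :: "real + real \<Rightarrow> real" where "p0 = (\<lambda>i. case i of Inl u \<Rightarrow> 1 | Inr t \<Rightarrow> 0)"
  define x0 where "x0 = (\<lambda>i::real + real. case i of Inl u \<Rightarrow> u | Inr t \<Rightarrow> 0)"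
  define p1 :: "real + real \<Rightarrow> real" where "p1 = (\<lambda>i. case i of Inl u \<Rightarrow> 0 | Inr t \<Rightarrow> 1)"
  define x1 where "x1 = (\<lambda>i::real + real. case i of Inl u \<Rightarrow> 0 | Inr t \<Rightarrow> t)"
  note defs = pB_def xB_def q_def p0_def x0_def p1_def x1_def
  have x01: "x0 i \<in> {0..1}" "x1 i \<in> {0..1}" "0 \<le> xB i" if "i \<in> J" for i
    using J that by (auto simp: defs split: sum.split)
  let ?K = "\<lambda>p x q y j k. p j * p k * min (x j) (x k) + p j * q k * min (x j) (y k) +
       q j * p k * min (y j) (x k) + q j * q k * min (y j) (y k) :: real"
  let ?V = "\<lambda>p x q y. \<Sum>j\<in>J. \<Sum>k\<in>J. s j * s k * ?K p x q y j k"
  let ?S0 = "\<lambda>w. \<Sum>j\<in>J. s j * (p0 j * w (x0 j) + q j * w 1)"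
  let ?S1 = "\<lambda>w. \<Sum>j\<in>J. s j * (p1 j * w (x1 j) + 0 * w 0)"
  let ?R = "\<lambda>X \<omega>. \<lambda>t\<in>{0..1::real}. X t \<omega> :: real"
  let ?P = "PiM {0..1::real} (\<lambda>_. borel :: real measure)"
  have [measurable]: "(\<lambda>w. w t) \<in> borel_measurable ?P" if "t \<in> {0..1}" for t
    using that by (rule measurable_component_singleton)
  have S [measurable]: "?S0 \<in> borel_measurable ?P" "?S1 \<in> borel_measurable ?P"
    using x01 by auto
  \<comment> \<open>Only the mixed cases use the position of the times: as
    \<open>u \<le> 1 \<le> 1 / t\<close>, the covariance of \<open>B u - u * B 1\<close> with
    \<open>t * B (1 / t)\<close> is \<open>t * u - u * t = 0\<close>.\<close>
  have K: "?K pB xB q (\<lambda>_. 1) j k = ?K p0 x0 q (\<lambda>_. 1) j k + ?K p1 x1 (\<lambda>_. 0) (\<lambda>_. 0) j k"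
    if "j \<in> J" "k \<in> J" for j k
  proof -
    have "j \<in> coords" "k \<in> coords" using J that by auto
    then show ?thesis
    proof (elim PlusE)
      fix u v assume "u \<in> {0..1::real}" "v \<in> {0..1::real}" "j = Inl u" "k = Inl v"
      then show ?thesis by (simp add: defs)
    next
      fix u t assume *: "u \<in> {0..1::real}" "t \<in> {0<..1::real}" "j = Inl u" "k = Inr t"
      then have t: "1 \<le> 1 / t" by simp
      have "u \<le> 1 / t"
        by (rule order_trans[OF _ t]) (use * in simp)
      with t have "min u (1 / t) = u" "min 1 (1 / t) = 1"
        by (simp_all only: min.absorb1 min.absorb2)
      with * show ?thesis by (simp add: defs)
    next
      fix u t assume *: "t \<in> {0<..1::real}" "u \<in> {0..1::real}" "j = Inr t" "k = Inl u"
      then have t: "1 \<le> 1 / t" by simp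
      have "u \<le> 1 / t"
        by (rule order_trans[OF _ t]) (use * in simp)
      with t have "min (1 / t) u = u" "min (1 / t) 1 = 1"
        by (simp_all only: min.absorb1 min.absorb2)
      with * show ?thesis by (simp add: defs)
    next
      fix a t assume "a \<in> {0<..1::real}" "t \<in> {0<..1::real}" "j = Inr a" "k = Inr t"
      then show ?thesis using inversion_covariance[of a t] by (simp add: defs)
    qed
  qed
  \<comment> \<open>Additivity of the variances makes the Gaussian characteristic function a
    product, which independence of \<open>W\<close> and \<open>W0\<close> turns back into one
    expectation.\<close>
  have V: "?V pB xB q (\<lambda>_. 1) = ?V p0 x0 q (\<lambda>_. 1) + ?V p1 x1 (\<lambda>_. 0) (\<lambda>_. 0)"
    unfolding sum.distrib[symmetric] by (intro sum.cong refl) (subst K, assumption+, rule distrib_left)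
  have exp_half: "complex_of_real (exp (- (a + b) / 2)) = complex_of_real (exp (- a / 2)) * complex_of_real (exp (- b / 2))"
    for a b :: real
    by (simp only: exp_add[symmetric] of_real_mult[symmetric]) (simp add: field_simps)
  have "(CLINT \<omega>|M. iexp (\<Sum>j\<in>J. s j * (case j of Inl u \<Rightarrow> B u \<omega> - u * B 1 \<omega> | Inr t \<Rightarrow> t * B (1 / t) \<omega>))) =
      (CLINT \<omega>|M. iexp (\<Sum>j\<in>J. s j * (pB j * B (xB j) \<omega> + q j * B 1 \<omega>)))"
    by (intro Bochner_Integration.integral_cong refl arg_cong[of _ _ iexp] sum.cong) (auto simp: defs split: sum.split)
  also have "\<dots> = complex_of_real (exp (- ?V pB xB q (\<lambda>_. 1) / 2))"
    using x01 by (intro brownian_pair_char[OF B _ _ J(1)]) auto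
  also have "\<dots> = complex_of_real (exp (- ?V p0 x0 q (\<lambda>_. 1) / 2)) *
      complex_of_real (exp (- ?V p1 x1 (\<lambda>_. 0) (\<lambda>_. 0) / 2))"
    unfolding V by (rule exp_half)
  also have "complex_of_real (exp (- ?V p0 x0 q (\<lambda>_. 1) / 2)) = (CLINT \<omega>|N. iexp (?S0 (\<lambda>t. W0 t \<omega>)))"
    using x01 by (intro brownian_pair_char[OF W0 _ _ J(1), symmetric]) auto
  also have "complex_of_real (exp (- ?V p1 x1 (\<lambda>_. 0) (\<lambda>_. 0) / 2)) = (CLINT \<omega>|N. iexp (?S1 (\<lambda>t. W t \<omega>)))"
    using x01 by (intro brownian_pair_char[OF W _ _ J(1), symmetric]) auto
  also have "(CLINT \<omega>|N. iexp (?S0 (\<lambda>t. W0 t \<omega>))) * (CLINT \<omega>|N. iexp (?S1 (\<lambda>t. W t \<omega>))) =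
      (CLINT \<omega>|N. iexp (?S1 (\<lambda>t. W t \<omega>))) * (CLINT \<omega>|N. iexp (?S0 (\<lambda>t. W0 t \<omega>)))"
    by (rule mult.commute)
  also have "\<dots> = (CLINT \<omega>|N. iexp (?S1 (\<lambda>t. W t \<omega>)) * iexp (?S0 (\<lambda>t. W0 t \<omega>)))"
  proof (rule N.indep_var_lebesgue_integral[symmetric])
    \<comment> \<open>Independence is given for the restricted paths as random elements of the
      product space, so each exponential is first viewed as a measurable function of such a
      path.\<close>
    have "N.indep_var borel ((\<lambda>w. iexp (?S1 w)) \<circ> ?R W) borel ((\<lambda>w. iexp (?S0 w)) \<circ> ?R W0)"
      using indep unfolding indep_processes_def
      by (rule N.indep_var_compose) measurable
    moreover have "(\<lambda>w. iexp (?S1 w)) \<circ> ?R W = (\<lambda>\<omega>. iexp (?S1 (\<lambda>t. W t \<omega>)))"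
      using x01 by (auto simp: fun_eq_iff intro!: arg_cong[of _ _ exp] sum.cong)
    moreover have "(\<lambda>w. iexp (?S0 w)) \<circ> ?R W0 = (\<lambda>\<omega>. iexp (?S0 (\<lambda>t. W0 t \<omega>)))"
      using x01 by (auto simp: fun_eq_iff intro!: arg_cong[of _ _ exp] sum.cong)
    ultimately show "N.indep_var borel (\<lambda>\<omega>. iexp (?S1 (\<lambda>t. W t \<omega>))) borel (\<lambda>\<omega>. iexp (?S0 (\<lambda>t. W0 t \<omega>)))"
      by simp
    have SW: "(\<lambda>\<omega>. ?S1 (\<lambda>t. W t \<omega>)) \<in> borel_measurable N" "(\<lambda>\<omega>. ?S0 (\<lambda>t. W0 t \<omega>)) \<in> borel_measurable N"
      using x01 by auto
    show "complex_integrable N (\<lambda>\<omega>. iexp (?S1 (\<lambda>t. W t \<omega>)))"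
      by (rule N.integrable_iexp) (rule measurable_compose[OF SW(1) borel_measurable_of_real], rule Im_complex_of_real)
    show "complex_integrable N (\<lambda>\<omega>. iexp (?S0 (\<lambda>t. W0 t \<omega>)))"
      by (rule N.integrable_iexp) (rule measurable_compose[OF SW(2) borel_measurable_of_real], rule Im_complex_of_real)
  qed
  also have "\<dots> = (CLINT \<omega>|N. iexp (\<Sum>j\<in>J. s j * (case j of Inl u \<Rightarrow> W0 u \<omega> - u * W0 1 \<omega> | Inr t \<Rightarrow> W t \<omega>)))"
  proof (intro Bochner_Integration.integral_cong refl)
    fix \<omega>
    have "?S1 (\<lambda>t. W t \<omega>) + ?S0 (\<lambda>t. W0 t \<omega>) =
        (\<Sum>j\<in>J. s j * (case j of Inl u \<Rightarrow> W0 u \<omega> - u * W0 1 \<omega> | Inr t \<Rightarrow> W t \<omega>))"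
      unfolding sum.distrib[symmetric] by (intro sum.cong refl) (auto simp: defs split: sum.split)
    then show "iexp (?S1 (\<lambda>t. W t \<omega>)) * iexp (?S0 (\<lambda>t. W0 t \<omega>)) =
        iexp (\<Sum>j\<in>J. s j * (case j of Inl u \<Rightarrow> W0 u \<omega> - u * W0 1 \<omega> | Inr t \<Rightarrow> W t \<omega>))"
      by (simp only: exp_add[symmetric] ring_distribs(1)[symmetric] of_real_add[symmetric])
  qed
  finally show "(CLINT \<omega>|M. iexp (\<Sum>j\<in>J. s j * (case j of Inl u \<Rightarrow> B u \<omega> - u * B 1 \<omega> | Inr t \<Rightarrow> t * B (1 / t) \<omega>))) =
    (CLINT \<omega>|N. iexp (\<Sum>j\<in>J. s j * (case j of Inl u \<Rightarrow> W0 u \<omega> - u * W0 1 \<omega> | Inr t \<Rightarrow> W t \<omega>)))" .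
qed

section \<open>Equality in law of the self-normalised suprema\<close>

theorem lemma1:
  fixes g :: "real \<Rightarrow> real"
    and M :: "'a measure" and B :: "real \<Rightarrow> 'a \<Rightarrow> real"
    and N :: "'b measure" and W W0 :: "real \<Rightarrow> 'b \<Rightarrow> real"
  assumes g_pos: "\<And>x. 1 \<le> x \<Longrightarrow> 0 < g x"
    and g_cont: "continuous_on {1..} g"
    and g_mono: "mono_on {1..} g"
    and g_lil: "((\<lambda>\<tau>. sqrt (\<tau> * ln (ln \<tau>)) / g \<tau>) \<longlongrightarrow> 0) at_top"
    and g_sum: "((\<lambda>T::real. \<Sum>l::nat. ennreal (2 ^ l * T / (g (2 ^ l * T))\<^sup>2)) \<longlongrightarrow> 0) at_top"
    and B: "std_brownian_motion {0..} M B"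
    and W: "std_brownian_motion {0..1} N W"
    and W0: "std_brownian_motion {0..1} N W0"
    and indep: "indep_processes {0..1} N W W0"
  shows "eq_in_distr M (G_stat g B)
           N (\<lambda>\<omega>. 1 / ennreal (bridge_norm W0 \<omega>) *
                  (SUP (t, v)\<in>{(t, v). 0 < t \<and> t \<le> v \<and> v \<le> 1}.
                     ennreal (\<bar>W v \<omega> - W t \<omega>\<bar> / (v * g (1 / t)))))"
proof -
  define R where "R = {(t, v). 0 < t \<and> t \<le> v \<and> v \<le> (1::real)}"
  \<comment> \<open>One countable dense set, chosen before any path, serves both probability spaces,
    so both statistics are almost surely the same functional
    \<open>stat_functional g D\<close>.\<close>
  obtain D where D: "countable D" "D \<subseteq> R" "R \<subseteq> closure D"
    using separable[of R] by blast
  have path: "stat_functional g D y = 1 / ennreal (sqrt (LBINT u:{0..1}. (b u)\<^sup>2)) *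
     (SUP (t, v)\<in>R. ennreal (\<bar>q v - q t\<bar> / (v * g (1 / t))))"
    if "continuous_on {0..1} b" "continuous_on {0<..1} q"
      "\<And>u. u \<in> {0..1} \<Longrightarrow> y (Inl u) = b u" "\<And>t. t \<in> {0<..1} \<Longrightarrow> y (Inr t) = q t" for y b q
    unfolding R_def
    by (rule stat_functional_path[OF g_pos g_cont D(2,3)[unfolded R_def] that])
  have [measurable]: "0 \<le> t \<Longrightarrow> B t \<in> borel_measurable M" for t
    using B by (simp add: std_brownian_motion_def)
  have [measurable]: "0 \<le> t \<Longrightarrow> t \<le> 1 \<Longrightarrow> W t \<in> borel_measurable N"
     "0 \<le> t \<Longrightarrow> t \<le> 1 \<Longrightarrow> W0 t \<in> borel_measurable N" for t
    using W W0 by (simp_all add: std_brownian_motion_def)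
  show ?thesis
  proof (rule eq_in_distrI[OF stat_functional_measurable[OF D(1)] _ _ bridge_inversion_law[OF B W W0 indep]])
    show "D \<subseteq> {0<..1} \<times> {0<..1}"
      using D(2) by (auto simp: R_def)
    show "(\<lambda>\<omega>. \<lambda>i\<in>coords. case i of Inl u \<Rightarrow> B u \<omega> - u * B 1 \<omega> | Inr t \<Rightarrow> t * B (1 / t) \<omega>)
        \<in> M \<rightarrow>\<^sub>M PiM coords (\<lambda>_. borel)"
      by (rule measurable_restrict) auto
    show "(\<lambda>\<omega>. \<lambda>i\<in>coords. case i of Inl u \<Rightarrow> W0 u \<omega> - u * W0 1 \<omega> | Inr t \<Rightarrow> W t \<omega>)
        \<in> N \<rightarrow>\<^sub>M PiM coords (\<lambda>_. borel)"
      by (rule measurable_restrict) auto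
    have "AE \<omega> in M. continuous_on {0..} (\<lambda>t. B t \<omega>)"
      using B by (simp add: std_brownian_motion_def)
    then show "AE \<omega> in M. G_stat g B \<omega> = stat_functional g D
        (\<lambda>i\<in>coords. case i of Inl u \<Rightarrow> B u \<omega> - u * B 1 \<omega> | Inr t \<Rightarrow> t * B (1 / t) \<omega>)"
    proof eventually_elim
      case (elim \<omega>)
      have "continuous_on {0..1} (\<lambda>u. B u \<omega> - u * B 1 \<omega>)"
        by (intro continuous_intros continuous_on_subset[OF elim]) auto
      moreover have "continuous_on {0<..1} (\<lambda>t. t * B (1 / t) \<omega>)"
        by (intro continuous_intros continuous_on_compose2[OF elim]) auto
      ultimately have "stat_functional g D
          (\<lambda>i\<in>coords. case i of Inl u \<Rightarrow> B u \<omega> - u * B 1 \<omega> | Inr t \<Rightarrow> t * B (1 / t) \<omega>) =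
          1 / ennreal (sqrt (LBINT u:{0..1}. (B u \<omega> - u * B 1 \<omega>)\<^sup>2)) *
          (SUP (t, v)\<in>R. ennreal (\<bar>v * B (1 / v) \<omega> - t * B (1 / t) \<omega>\<bar> / (v * g (1 / t))))"
        by (rule path) auto
      then show ?case
        by (simp only: G_stat_def bridge_norm_def SUP_time_inversion[where B="\<lambda>t. B t \<omega>"] R_def)
    qed
    have "AE \<omega> in N. continuous_on {0..1} (\<lambda>t. W t \<omega>)" "AE \<omega> in N. continuous_on {0..1} (\<lambda>t. W0 t \<omega>)"
      using W W0 by (simp_all add: std_brownian_motion_def)
    then show "AE \<omega> in N. 1 / ennreal (bridge_norm W0 \<omega>) *
          (SUP (t, v)\<in>{(t, v). 0 < t \<and> t \<le> v \<and> v \<le> 1}. ennreal (\<bar>W v \<omega> - W t \<omega>\<bar> / (v * g (1 / t)))) =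
        stat_functional g D (\<lambda>i\<in>coords. case i of Inl u \<Rightarrow> W0 u \<omega> - u * W0 1 \<omega> | Inr t \<Rightarrow> W t \<omega>)"
    proof eventually_elim
      case (elim \<omega>)
      have "continuous_on {0..1} (\<lambda>u. W0 u \<omega> - u * W0 1 \<omega>)"
        by (intro continuous_on_diff elim(2) continuous_on_mult_right continuous_on_id)
      moreover have "continuous_on {0<..1} (\<lambda>t. W t \<omega>)"
        by (rule continuous_on_subset[OF elim(1)]) auto
      ultimately have "stat_functional g D
          (\<lambda>i\<in>coords. case i of Inl u \<Rightarrow> W0 u \<omega> - u * W0 1 \<omega> | Inr t \<Rightarrow> W t \<omega>) =
          1 / ennreal (sqrt (LBINT u:{0..1}. (W0 u \<omega> - u * W0 1 \<omega>)\<^sup>2)) *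
          (SUP (t, v)\<in>R. ennreal (\<bar>W v \<omega> - W t \<omega>\<bar> / (v * g (1 / t))))"
        by (rule path) auto
      then show ?case
        by (simp only: bridge_norm_def R_def)
    qed
  qed
qed

end
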